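(* Let $\mathbb{X}$ be a reflexive, Kadets-Klee real Banach space and let $\mathbb{Y}$ be a real Banach space. Let $T\in\mathbb{K}(\mathbb{X},\mathbb{Y})$ with $\|T\|=1$ be such that $T$ is not an extreme contraction. Then for each $\epsilon>0$, $T$ admits a non-trivial uniform $\epsilon$-BPB approximation $A_\epsilon$ such that $M_{A_\epsilon}=M_T$. Moreover, $A_\epsilon$ is not an extreme contraction (that is, $A_\epsilon$ can be chosen with all these properties simultaneously).
   Context: All Banach spaces are over $\mathbb{R}$. $\mathbb{L}(\mathbb{X},\mathbb{Y})$ (resp. $\mathbb{K}(\mathbb{X},\mathbb{Y})$) is the space of bounded (resp. compact) linear operators with the operator norm; $S_Z$ is the unit sphere of a normed space $Z$. For $A\in\mathbb{L}(\mathbb{X},\mathbb{Y})$, $M_A=\{x\in S_{\mathbb{X}}:\|Ax\|=\|A\|\}$. $\mathbb{X}$ is Kadets-Klee if $x_n\to x$ weakly and $\|x_n\|\to\|x\|$ imply $x_n\to x$ in norm. An extreme contraction is an extreme point of the closed unit ball of $\mathbb{L}(\mathbb{X},\mathbb{Y})$. For $T\in S_{\mathbb{L}(\mathbb{X},\mathbb{Y})}$ and $\epsilon>0$, an operator $A\in S_{\mathbb{L}(\mathbb{X},\mathbb{Y})}$ is a uniform $\epsilon$-BPB approximation of $T$ if $\|T-A\|<\epsilon$ and there exists $\delta(\epsilon)>0$ such that for each $x_0\in S_{\mathbb{X}}$ with $\|Tx_0\|>1-\delta(\epsilon)$ there exists $u_0\in M_A$ with $\|u_0-x_0\|<\epsilon$.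 It is non-trivial if in addition $A\neq T$. *)

theory Defs
  imports "HOL-Analysis.Analysis"
begin

definition bidual_embedding ::
    "'a::real_normed_vector \<Rightarrow> (('a \<Rightarrow>\<^sub>L real) \<Rightarrow>\<^sub>L real)"
  where "bidual_embedding x = Blinfun (\<lambda>f. blinfun_apply f x)"

(* Blinfun is only meaningful on bounded linear maps, which evaluation at x is. *)
lemma blinfun_apply_bidual_embedding [simp]:
  "blinfun_apply (bidual_embedding x) f = blinfun_apply f x"
  unfolding bidual_embedding_def
  by (subst bounded_linear_Blinfun_apply)
     (auto intro!: bounded_linear_intros)

definition reflexive_space :: "'a::real_normed_vector itself \<Rightarrow> bool"
  where "reflexive_space _ \<longleftrightarrow>
    surj (bidual_embedding :: 'a \<Rightarrow> (('a \<Rightarrow>\<^sub>L real) \<Rightarrow>\<^sub>L real))"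

definition weakly_converges :: "(nat \<Rightarrow> 'a::real_normed_vector) \<Rightarrow> 'a \<Rightarrow> bool"
  where "weakly_converges X x \<longleftrightarrow>
    (\<forall>f :: 'a \<Rightarrow>\<^sub>L real. (\<lambda>n. blinfun_apply f (X n)) \<longlonglongrightarrow> blinfun_apply f x)"

definition kadets_klee_space :: "'a::real_normed_vector itself \<Rightarrow> bool"
  where "kadets_klee_space _ \<longleftrightarrow>
    (\<forall>(X :: nat \<Rightarrow> 'a) x.
       weakly_converges X x \<longrightarrow> (\<lambda>n. norm (X n)) \<longlonglongrightarrow> norm x \<longrightarrow> X \<longlonglongrightarrow> x)"

definition compact_operator ::
    "('a::real_normed_vector \<Rightarrow>\<^sub>L 'b::real_normed_vector) \<Rightarrow> bool"
  where "compact_operator A \<longleftrightarrow> compact (closure (blinfun_apply A ` cball 0 1))"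

definition norm_attainment_set ::
    "('a::real_normed_vector \<Rightarrow>\<^sub>L 'b::real_normed_vector) \<Rightarrow> 'a set"
  where "norm_attainment_set A = {x \<in> sphere 0 1. norm (blinfun_apply A x) = norm A}"

definition extreme_contraction ::
    "('a::real_normed_vector \<Rightarrow>\<^sub>L 'b::real_normed_vector) \<Rightarrow> bool"
  where "extreme_contraction A \<longleftrightarrow> A extreme_point_of (cball 0 1)"

definition uniform_BPB_approximation ::
    "real \<Rightarrow> ('a::real_normed_vector \<Rightarrow>\<^sub>L 'b::real_normed_vector) \<Rightarrow> ('a \<Rightarrow>\<^sub>L 'b) \<Rightarrow> bool"
  where "uniform_BPB_approximation \<epsilon> T A \<longleftrightarrow>
    T \<in> sphere 0 1 \<and> A \<in> sphere 0 1 \<and> norm (T - A) < \<epsilon> \<and>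
    (\<exists>\<delta>>0. \<forall>x\<^sub>0 \<in> sphere 0 1. norm (blinfun_apply T x\<^sub>0) > 1 - \<delta> \<longrightarrow>
       (\<exists>u\<^sub>0 \<in> norm_attainment_set A. norm (u\<^sub>0 - x\<^sub>0) < \<epsilon>))"

definition nontrivial_uniform_BPB_approximation ::
    "real \<Rightarrow> ('a::real_normed_vector \<Rightarrow>\<^sub>L 'b::real_normed_vector) \<Rightarrow> ('a \<Rightarrow>\<^sub>L 'b) \<Rightarrow> bool"
  where "nontrivial_uniform_BPB_approximation \<epsilon> T A \<longleftrightarrow>
    uniform_BPB_approximation \<epsilon> T A \<and> A \<noteq> T"

end

(*
  As T is not extreme, T + S and T - S are contractions for some S \<noteq> 0. Take A = T + t S with a
  small t > 0. For every unit vector x the function t \<mapsto> \<parallel>T x + t S x\<parallel> is convex and at most 1 on [-1, 1], so it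
  is constantly 1 once it equals 1 at an interior point; hence A and T attain their norm at the same
  points. It remains to see that almost maximizers of T are close to M_T. Otherwise some x_n
  in the unit sphere with \<parallel>T x_n\<parallel> \<rightarrow> 1 stay away from M_T; by reflexivity a subsequence converges weakly, by
  compactness its image converges in norm, so the limit is a unit vector in M_T, and by the
  Kadets-Klee property the convergence is in norm, a contradiction. The Hahn-Banach theorem is obtained
  from minimal sublinear functionals, weak sequential compactness of balls from Tychonoff's theorem.
*)

theory Submission
  imports Defs
begin

section \<open>The Hahn-Banach theorem\<close>

text \<open>Homogeneity is demanded only as an inequality, so less has to be verified for each new
  functional; applying it to \<open>1 / r\<close> as well gives the equality.\<close>

definition sublinear :: "('a::real_vector \<Rightarrow> real) \<Rightarrow> bool"
  where "sublinear p \<longleftrightarrow>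
    (\<forall>x y. p (x + y) \<le> p x + p y) \<and> (\<forall>r\<ge>0. \<forall>x. p (r *\<^sub>R x) \<le> r * p x)"

lemma sublinearD:
  assumes "sublinear p"
  shows "p (x + y) \<le> p x + p y" and "r \<ge> 0 \<Longrightarrow> p (r *\<^sub>R x) \<le> r * p x"
  using assms by (auto simp: sublinear_def)

lemma sublinear_0: "sublinear p \<Longrightarrow> p 0 = 0"
  using sublinearD(1)[of p 0 0] sublinearD(2)[of p 0 0] by simp

lemma sublinear_scaleR:
  assumes "sublinear p" "r \<ge> 0"
  shows "p (r *\<^sub>R x) = r * p x"
proof (cases "r = 0")
  case True
  then show ?thesis using sublinear_0[OF assms(1)] by simp
next
  case False
  then have "r > 0" using assms(2) by simp
  have "p ((1 / r) *\<^sub>R (r *\<^sub>R x)) \<le> (1 / r) * p (r *\<^sub>R x)"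
    using \<open>r > 0\<close> by (intro sublinearD(2)[OF assms(1)]) simp
  then have "r * p x \<le> p (r *\<^sub>R x)"
    using \<open>r > 0\<close> by (simp add: field_simps)
  then show ?thesis using sublinearD(2)[OF assms, of x] by simp
qed

text \<open>This supplies the lower bounds that make infima of sublinear functionals finite.\<close>

lemma sublinear_minus_le: "sublinear p \<Longrightarrow> - p (- x) \<le> p x"
  using sublinearD(1)[of p x "- x"] sublinear_0[of p] by simp

text \<open>The functional \<open>q\<close> is the infimum of
  \<open>p (w + t *\<^sub>R x) - t * p x\<close> over t >= 0. Its value at - x is at most - p x,
  which fixes at x every linear functional below \<open>q\<close>. For minimal \<open>p\<close> it
  equals \<open>p\<close>, and the last property becomes the missing half of additivity.\<close>

lemma sublinear_slide:
  fixes p :: "'a::real_vector \<Rightarrow> real"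
  assumes p: "sublinear p"
  obtains q where "sublinear q" and "\<And>w. q w \<le> p w"
    and "\<And>w t. t \<ge> 0 \<Longrightarrow> q w \<le> p (w + t *\<^sub>R x) - t * p x"
proof -
  define h where "h w t = p (w + t *\<^sub>R x) - t * p x" for w t
  define q where "q w = (INF t\<in>{0..}. h w t)" for w
  have lower: "- p (- w) \<le> h w t" if "t \<ge> 0" for w t
    using sublinearD(1)[OF p, of "- w" "w + t *\<^sub>R x"] sublinear_scaleR[OF p that, of x]
    by (simp add: h_def)
  have le: "q w \<le> h w t" if "t \<ge> 0" for w t
    unfolding q_def using that by (auto intro!: cINF_lower bdd_belowI2[OF lower])
  have greatest: "c \<le> q w" if "\<And>t. t \<ge> 0 \<Longrightarrow> c \<le> h w t" for c w
    unfolding q_def using that by (auto intro!: cINF_greatest)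
  have add: "q (v + w) \<le> q v + q w" for v w
  proof -
    \<comment> \<open>Parameters s for v and t for w combine to the parameter s + t for v +
      w.\<close>
    have "q (v + w) - h v s \<le> h w t" if "s \<ge> 0" "t \<ge> 0" for s t
      using le[of "s + t" "v + w"] that sublinearD(1)[OF p, of "v + s *\<^sub>R x" "w + t *\<^sub>R x"]
      by (simp add: h_def algebra_simps)
    then have "q (v + w) - h v s \<le> q w" if "s \<ge> 0" for s
      using that by (intro greatest) auto
    then have "q (v + w) - q w \<le> q v"
      by (intro greatest) (simp add: algebra_simps)
    then show ?thesis by simp
  qed
  have scale: "q (r *\<^sub>R w) \<le> r * q w" if "r \<ge> 0" for r w
  proof (cases "r = 0")
    case True
    then show ?thesis using le[of 0 0] sublinear_0[OF p] by (simp add: h_def)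
  next
    case False
    then have "r > 0" using that by simp
    have "q (r *\<^sub>R w) / r \<le> h w t" if "t \<ge> 0" for t
    proof -
      have "q (r *\<^sub>R w) \<le> h (r *\<^sub>R w) (r * t)"
        using that \<open>r > 0\<close> by (intro le) simp
      also have "\<dots> = r * h w t"
        using sublinear_scaleR[OF p, of r "w + t *\<^sub>R x"] \<open>r > 0\<close>
        by (simp add: h_def algebra_simps)
      finally show ?thesis using \<open>r > 0\<close> by (simp add: field_simps)
    qed
    then have "q (r *\<^sub>R w) / r \<le> q w" by (rule greatest)
    then show ?thesis using \<open>r > 0\<close> by (simp add: field_simps)
  qed
  show ?thesis
  proof
    show "sublinear q" using add scale by (auto simp: sublinear_def)
    show "q w \<le> p w" for w using le[of 0 w] by (simp add: h_def)
    show "q w \<le> p (w + t *\<^sub>R x) - t * p x" if "t \<ge> 0" for w t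
      using le[OF that] by (simp add: h_def)
  qed
qed

text \<open>This is the bound for chains in Zorn's lemma. The common majorant \<open>p\<close> gives
  the lower bound - p (- x) for all members, so the infimum is finite.\<close>

lemma sublinear_chain_INF:
  fixes C :: "('a::real_vector \<Rightarrow> real) set"
  assumes "C \<noteq> {}" and chain: "\<And>q r. q \<in> C \<Longrightarrow> r \<in> C \<Longrightarrow> q \<le> r \<or> r \<le> q"
    and sub: "\<And>q. q \<in> C \<Longrightarrow> sublinear q" and le: "\<And>q. q \<in> C \<Longrightarrow> q \<le> p"
  shows "sublinear (\<lambda>x. INF q\<in>C. q x)" and "\<And>q. q \<in> C \<Longrightarrow> (\<lambda>x. INF q\<in>C. q x) \<le> q"
proof -
  define u where "u x = (INF q\<in>C. q x)" for x
  have lower: "- p (- x) \<le> q x" if "q \<in> C" for q x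
    using sublinear_minus_le[OF sub[OF that], of x] le_funD[OF le[OF that], of "- x"] by simp
  have u_le: "u x \<le> q x" if "q \<in> C" for q x
    unfolding u_def using that by (auto intro!: cINF_lower bdd_belowI2[OF lower])
  have greatest: "c \<le> u x" if "\<And>q. q \<in> C \<Longrightarrow> c \<le> q x" for c x
    unfolding u_def using that \<open>C \<noteq> {}\<close> by (auto intro!: cINF_greatest)
  have add: "u (x + y) \<le> u x + u y" for x y
  proof -
    \<comment> \<open>Different members may be nearly optimal at x and at y; the smaller of the two
      serves for both.\<close>
    have "u (x + y) - q x \<le> r y" if qr: "q \<in> C" "r \<in> C" for q r
    proof -
      from chain[OF qr] obtain s where "s \<in> C" "s \<le> q" "s \<le> r" using qr by auto
      then show ?thesis
        using u_le[OF \<open>s \<in> C\<close>, of "x + y"] sublinearD(1)[OF sub[OF \<open>s \<in> C\<close>], of x y]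
          le_funD[OF \<open>s \<le> q\<close>, of x] le_funD[OF \<open>s \<le> r\<close>, of y] by linarith
    qed
    then have "u (x + y) - q x \<le> u y" if "q \<in> C" for q
      using that by (intro greatest) auto
    then have "u (x + y) - u y \<le> u x"
      by (intro greatest) (simp add: algebra_simps)
    then show ?thesis by simp
  qed
  have scale: "u (r *\<^sub>R x) \<le> r * u x" if "r \<ge> 0" for r x
  proof (cases "r = 0")
    case True
    obtain q where "q \<in> C" using \<open>C \<noteq> {}\<close> by auto
    then show ?thesis using u_le[of q 0] sublinear_0[OF sub[of q]] True by simp
  next
    case False
    then have "r > 0" using that by simp
    have "u (r *\<^sub>R x) / r \<le> q x" if "q \<in> C" for q
      using u_le[OF that, of "r *\<^sub>R x"] sublinear_scaleR[OF sub[OF that], of r x] \<open>r > 0\<close>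
      by (simp add: field_simps)
    then have "u (r *\<^sub>R x) / r \<le> u x" by (rule greatest)
    then show ?thesis using \<open>r > 0\<close> by (simp add: field_simps)
  qed
  show "sublinear (\<lambda>x. INF q\<in>C. q x)"
    using add scale by (auto simp: sublinear_def u_def)
  show "(\<lambda>x. INF q\<in>C. q x) \<le> q" if "q \<in> C" for q
    using u_le[OF that] by (auto simp: le_fun_def u_def)
qed

text \<open>A minimal sublinear functional is additive, since sliding it cannot decrease it any further.\<close>

lemma linear_le_sublinear:
  fixes p :: "'a::real_vector \<Rightarrow> real"
  assumes p: "sublinear p"
  obtains f where "linear f" and "f \<le> p"
proof -
  define A where "A = {q. sublinear q \<and> q \<le> p}"
  \<comment> \<open>Zorn's lemma is used for the reversed order, so it yields a minimal
    functional.\<close>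
  have "partial_order_on A (relation_of (\<ge>) A)"
    by (rule partial_order_on_relation_ofI) auto
  moreover have "\<exists>u\<in>A. \<forall>a\<in>C. a \<ge> u" if "C \<in> Chains (relation_of (\<ge>) A)" for C
  proof (cases "C = {}")
    case True
    then show ?thesis using p by (auto simp: A_def)
  next
    case False
    have CA: "C \<subseteq> A" and chain: "\<And>q r. q \<in> C \<Longrightarrow> r \<in> C \<Longrightarrow> q \<le> r \<or> r \<le> q"
      using that by (auto simp: Chains_def relation_of_def)
    have sub: "\<And>q. q \<in> C \<Longrightarrow> sublinear q" and le: "\<And>q. q \<in> C \<Longrightarrow> q \<le> p"
      using CA by (auto simp: A_def)
    have u: "sublinear (\<lambda>x. INF q\<in>C. q x)" "\<And>q. q \<in> C \<Longrightarrow> (\<lambda>x. INF q\<in>C. q x) \<le> q"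
      using sublinear_chain_INF[of C p] False chain sub le by blast+
    obtain q where "q \<in> C" using False by auto
    have "(\<lambda>x. INF q\<in>C. q x) \<in> A"
      using u(1) order_trans[OF u(2)[OF \<open>q \<in> C\<close>] le[OF \<open>q \<in> C\<close>]] by (simp add: A_def)
    then show ?thesis using u(2) by blast
  qed
  ultimately have "\<exists>m\<in>A. \<forall>a\<in>A. m \<ge> a \<longrightarrow> a = m" by (rule predicate_Zorn)
  then obtain m where "m \<in> A" and min: "\<And>a. a \<in> A \<Longrightarrow> a \<le> m \<Longrightarrow> a = m" by blast
  then have m: "sublinear m" and "m \<le> p" by (auto simp: A_def)
  have add: "m (w + x) = m w + m x" for w x
  proof -
    obtain q where q: "sublinear q" "\<And>w. q w \<le> m w"
      "\<And>w t. t \<ge> 0 \<Longrightarrow> q w \<le> m (w + t *\<^sub>R x) - t * m x"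
      using sublinear_slide[OF m, of x] by blast
    have "q \<le> m" using q(2) by (simp add: le_fun_def)
    then have "q = m" using q(1) order_trans[OF _ \<open>m \<le> p\<close>] by (intro min) (auto simp: A_def)
    then show ?thesis using q(3)[of 1 w] sublinearD(1)[OF m, of w x] by simp
  qed
  have neg: "m (- x) = - m x" for x
    using add[of x "- x"] sublinear_0[OF m] by simp
  have "m (r *\<^sub>R x) = r * m x" for r x
    using sublinear_scaleR[OF m, of r x] sublinear_scaleR[OF m, of "- r" x] neg[of "r *\<^sub>R x"]
    by (cases "r \<ge> 0") auto
  then have "linear m" using add by (intro linearI) auto
  then show ?thesis using \<open>m \<le> p\<close> that by blast
qed

text \<open>A linear functional below the functional slid along x takes the value p x at x. With
  \<open>p\<close> the norm this gives norming functionals, with \<open>p\<close> the distance to a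
  subspace it gives separation.\<close>

theorem Hahn_Banach_sublinear:
  fixes p :: "'a::real_normed_vector \<Rightarrow> real"
  assumes p: "sublinear p" and p_le: "\<And>w. p w \<le> norm w"
  obtains f :: "'a \<Rightarrow>\<^sub>L real" where "norm f \<le> 1" and "\<And>w. f w \<le> p w" and "f x = p x"
proof -
  obtain q where q: "sublinear q" "\<And>w. q w \<le> p w"
    "\<And>w t. t \<ge> 0 \<Longrightarrow> q w \<le> p (w + t *\<^sub>R x) - t * p x"
    using sublinear_slide[OF p, of x] by blast
  obtain g where g: "linear g" "g \<le> q" using linear_le_sublinear[OF q(1)] .
  have gp: "g w \<le> p w" for w using le_funD[OF g(2), of w] q(2)[of w] by simp
  have bound: "\<bar>g w\<bar> \<le> norm w" for w
    using gp[of w] gp[of "- w"] p_le[of w] p_le[of "- w"] linear_neg[OF g(1), of w] by simp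
  have "bounded_linear g"
    using g(1) bound by (intro bounded_linear.intro bounded_linear_axioms.intro)
      (auto intro!: exI[of _ 1])
  then have f: "blinfun_apply (Blinfun g) = g" by (rule bounded_linear_Blinfun_apply)
  have "g (- x) \<le> - p x"
    using le_funD[OF g(2), of "- x"] q(3)[of 1 "- x"] sublinear_0[OF p] by simp
  then have "g x = p x" using gp[of x] linear_neg[OF g(1), of x] by simp
  moreover have "norm (Blinfun g) \<le> 1"
    by (rule norm_blinfun_bound) (auto simp: f bound)
  ultimately show ?thesis using that[of "Blinfun g"] gp by (simp add: f)
qed

lemma norming_functional:
  fixes x :: "'a::real_normed_vector"
  obtains f :: "'a \<Rightarrow>\<^sub>L real" where "norm f \<le> 1" and "f x = norm x"
proof -
  have "sublinear (norm :: 'a \<Rightarrow> real)" by (auto simp: sublinear_def norm_triangle_ineq)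
  then show ?thesis using Hahn_Banach_sublinear[of norm x] that by auto
qed

lemma blinfun_apply_le: "norm f \<le> 1 \<Longrightarrow> \<bar>blinfun_apply (f :: _ \<Rightarrow>\<^sub>L real) x\<bar> \<le> norm x"
  using norm_blinfun[of f x] mult_right_mono[of "norm f" 1 "norm x"] by simp

lemma functionals_separate_points:
  fixes x y :: "'a::real_normed_vector"
  assumes "\<And>f :: 'a \<Rightarrow>\<^sub>L real. f x = f y"
  shows "x = y"
proof -
  obtain f :: "'a \<Rightarrow>\<^sub>L real" where "f (x - y) = norm (x - y)" by (rule norming_functional)
  then show ?thesis using assms[of f] by (simp add: blinfun.diff_right)
qed

section \<open>Separation of a point from a closed subspace\<close>

lemma sublinear_infdist:
  fixes Z :: "'a::real_normed_vector set"
  assumes Z: "subspace Z"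
  shows "sublinear (\<lambda>x. infdist x Z)"
proof -
  have ne: "Z \<noteq> {}" using subspace_0[OF Z] by auto
  have greatest: "c \<le> infdist x Z" if "\<And>a. a \<in> Z \<Longrightarrow> c \<le> dist x a" for c x
    unfolding infdist_notempty[OF ne] using that ne by (auto intro!: cINF_greatest)
  have add: "infdist (x + y) Z \<le> infdist x Z + infdist y Z" for x y
  proof -
    have "infdist (x + y) Z - dist x a \<le> dist y b" if "a \<in> Z" "b \<in> Z" for a b
      using infdist_le[of "a + b" Z "x + y"] subspace_add[OF Z that] dist_triangle_add[of x y a b]
      by simp
    then have "infdist (x + y) Z - dist x a \<le> infdist y Z" if "a \<in> Z" for a
      using that by (intro greatest) auto
    then have "infdist (x + y) Z - infdist y Z \<le> infdist x Z"
      by (intro greatest) (simp add: algebra_simps)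
    then show ?thesis by simp
  qed
  have "infdist (r *\<^sub>R x) Z \<le> r * infdist x Z" if "r \<ge> 0" for r x
  proof (cases "r = 0")
    case True
    then show ?thesis using infdist_zero[OF subspace_0[OF Z]] by simp
  next
    case False
    then have "r > 0" using that by simp
    have "infdist (r *\<^sub>R x) Z / r \<le> dist x a" if "a \<in> Z" for a
    proof -
      have "dist (r *\<^sub>R x) (r *\<^sub>R a) = r * dist x a"
        using \<open>r > 0\<close> by (simp add: dist_norm flip: scaleR_diff_right)
      then show ?thesis
        using infdist_le[OF subspace_scale[OF Z that], of "r *\<^sub>R x" r] \<open>r > 0\<close>
        by (simp add: field_simps)
    qed
    then have "infdist (r *\<^sub>R x) Z / r \<le> infdist x Z" by (rule greatest)
    then show ?thesis using \<open>r > 0\<close> by (simp add: field_simps)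
  qed
  then show ?thesis using add by (auto simp: sublinear_def)
qed

text \<open>A functional dominated by the distance to Z is at most 0 on Z, hence 0 there by
  symmetry; at x it equals the distance, which is positive because Z is closed.\<close>

lemma closed_subspace_separation:
  fixes Z :: "'a::real_normed_vector set"
  assumes Z: "subspace Z" "closed Z" and "x \<notin> Z"
  obtains f :: "'a \<Rightarrow>\<^sub>L real" where "\<And>z. z \<in> Z \<Longrightarrow> f z = 0" and "f x \<noteq> 0"
proof -
  have 0: "0 \<in> Z" using subspace_0[OF Z(1)] .
  have le: "infdist w Z \<le> norm w" for w using infdist_le[OF 0, of w] by simp
  obtain f :: "'a \<Rightarrow>\<^sub>L real" where f: "\<And>w. f w \<le> infdist w Z" "f x = infdist x Z"
    using Hahn_Banach_sublinear[OF sublinear_infdist[OF Z(1)] le] by blast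
  show ?thesis
  proof
    show "f z = 0" if "z \<in> Z" for z
      using f(1)[of z] f(1)[of "- z"] that subspace_neg[OF Z(1) that] by (simp add: blinfun.minus_right)
    show "f x \<noteq> 0"
      using f(2) in_closed_iff_infdist_zero[OF Z(2), of x] 0 \<open>x \<notin> Z\<close> by auto
  qed
qed

section \<open>Weak sequential compactness in reflexive spaces\<close>

text \<open>Tychonoff's theorem, carried over from the abstract product topology to the function
  type.\<close>

lemma compact_PiE_UNIV:
  fixes S :: "'i \<Rightarrow> 'a::topological_space set"
  assumes "\<And>i. compact (S i)"
  shows "compact (Pi\<^sub>E UNIV S)"
  using assms compactin_PiE[of "\<lambda>_. euclidean" UNIV S] by (simp add: euclidean_product_topology)

text \<open>The evaluations at the points \<open>X k\<close> lie in a product of compact intervals,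
  so they have a cluster point. As a pointwise limit it is linear and bounded, and reflexivity
  represents it by a point. The finer filter \<open>G\<close> plays the role of a subnet.\<close>

lemma weak_cluster_point:
  fixes X :: "'i \<Rightarrow> 'a::real_normed_vector"
  assumes refl: "reflexive_space TYPE('a)" and F: "F \<noteq> bot" and B: "\<And>k. norm (X k) \<le> B"
  obtains G x where "G \<le> F" and "G \<noteq> bot"
    and "\<And>f :: 'a \<Rightarrow>\<^sub>L real. ((\<lambda>k. f (X k)) \<longlongrightarrow> f x) G"
proof -
  define g where "g k = (\<lambda>f :: 'a \<Rightarrow>\<^sub>L real. f (X k))" for k
  define S where "S = Pi\<^sub>E UNIV (\<lambda>f :: 'a \<Rightarrow>\<^sub>L real. cball 0 (norm f * B) :: real set)"
  have "compact S" unfolding S_def by (intro compact_PiE_UNIV compact_cball)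
  have gS: "g k \<in> S" for k
  proof -
    have "norm (blinfun_apply f (X k)) \<le> norm f * B" for f :: "'a \<Rightarrow>\<^sub>L real"
      using norm_blinfun[of f "X k"] mult_left_mono[OF B[of k], of "norm f"] by simp
    then show ?thesis by (auto simp: S_def g_def)
  qed
  have "filtermap g F \<noteq> bot" using F by (simp add: filtermap_bot_iff)
  moreover have "eventually (\<lambda>h. h \<in> S) (filtermap g F)"
    using gS by (simp add: eventually_filtermap)
  ultimately obtain L where "L \<in> S" and L: "inf (nhds L) (filtermap g F) \<noteq> bot"
    using \<open>compact S\<close> unfolding compact_filter by blast
  \<comment> \<open>Were this filter trivial, some neighbourhood of \<open>L\<close> would be
    avoided eventually along \<open>F\<close>, and \<open>L\<close> would not be a cluster
    point.\<close>
  define G where "G = inf (filtercomap g (nhds L)) F"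
  have "G \<noteq> bot"
  proof
    assume "G = bot"
    then have "eventually (\<lambda>_. False) G" by simp
    then obtain P Q where PQ: "eventually P (filtercomap g (nhds L))" "eventually Q F"
      "\<And>k. P k \<Longrightarrow> Q k \<Longrightarrow> False"
      unfolding G_def eventually_inf by auto
    then obtain R where R: "eventually R (nhds L)" "\<And>k. R (g k) \<Longrightarrow> P k"
      by (auto simp: eventually_filtercomap)
    have "eventually (\<lambda>h. \<not> R h) (filtermap g F)"
      using PQ(2) by (simp add: eventually_filtermap) (metis (mono_tags, lifting) PQ(3) R(2) eventually_mono)
    then have "eventually (\<lambda>_. False) (inf (nhds L) (filtermap g F))"
      unfolding eventually_inf using R(1) by blast
    then show False using L by (simp add: eventually_False)
  qed
  have "(g \<longlongrightarrow> L) G"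
    by (rule tendsto_mono[OF _ filterlim_filtercomap]) (simp add: G_def)
  then have lim: "((\<lambda>k. f (X k)) \<longlongrightarrow> L f) G" for f :: "'a \<Rightarrow>\<^sub>L real"
    using continuous_on_tendsto_compose[OF continuous_on_product_coordinates, of g L G f]
    by (simp add: g_def)
  have "bounded_linear L"
  proof (rule bounded_linear_intro)
    show "L (f + h) = L f + L h" for f h
      using tendsto_unique[OF \<open>G \<noteq> bot\<close> lim[of "f + h"]] tendsto_add[OF lim[of f] lim[of h]]
      by (simp add: blinfun.add_left)
    show "L (r *\<^sub>R f) = r *\<^sub>R L f" for r f
      using tendsto_unique[OF \<open>G \<noteq> bot\<close> lim[of "r *\<^sub>R f"]] tendsto_scaleR[OF tendsto_const lim[of f]]
      by (simp add: blinfun.scaleR_left)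
    show "norm (L f) \<le> norm f * B" for f
      using \<open>L \<in> S\<close> by (auto simp: S_def)
  qed
  then have "blinfun_apply (Blinfun L) = L" by (rule bounded_linear_Blinfun_apply)
  moreover obtain x where "bidual_embedding x = Blinfun L"
    using refl unfolding reflexive_space_def by (metis surjD)
  ultimately have "f x = L f" for f :: "'a \<Rightarrow>\<^sub>L real"
    by (metis blinfun_apply_bidual_embedding)
  then show ?thesis using that[of G x] \<open>G \<noteq> bot\<close> lim by (simp add: G_def)
qed

section \<open>Reduction to a separable subspace\<close>

lemma subspace_closure_rational_span:
  fixes Q :: "'a::real_normed_vector set"
  assumes "0 \<in> Q" and add: "\<And>u v. u \<in> Q \<Longrightarrow> v \<in> Q \<Longrightarrow> u + v \<in> Q"
    and scale: "\<And>r u. u \<in> Q \<Longrightarrow> real_of_rat r *\<^sub>R u \<in> Q"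
  shows "subspace (closure Q)"
  unfolding subspace_def
proof (intro conjI ballI allI)
  show "0 \<in> closure Q" using assms(1) closure_subset by blast
  show "u + v \<in> closure Q" if uv: "u \<in> closure Q" "v \<in> closure Q" for u v
  proof -
    obtain a b where "\<forall>n. a n \<in> Q" "a \<longlonglongrightarrow> u" "\<forall>n. b n \<in> Q" "b \<longlonglongrightarrow> v"
      using uv unfolding closure_sequential by blast
    then show ?thesis
      unfolding closure_sequential
      by (intro exI[of _ "\<lambda>n. a n + b n"]) (auto intro!: add tendsto_add)
  qed
  show "r *\<^sub>R u \<in> closure Q" if u: "u \<in> closure Q" for r u
  proof -
    obtain a where a: "\<forall>n. a n \<in> Q" "a \<longlonglongrightarrow> u"
      using u unfolding closure_sequential by blast
    have rat: "real_of_rat s *\<^sub>R u \<in> closure Q" for s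
      unfolding closure_sequential using a
      by (intro exI[of _ "\<lambda>n. real_of_rat s *\<^sub>R a n"]) (auto intro!: scale tendsto_intros)
    have "\<exists>y\<in>closure Q. dist y (r *\<^sub>R u) < e" if e: "e > 0" for e
    proof -
      \<comment> \<open>The added 1 avoids a division by zero when u = 0.\<close>
      have pos: "norm u + 1 > 0" using norm_ge_zero[of u] by linarith
      then obtain s where s: "r < real_of_rat s" "real_of_rat s < r + e / (norm u + 1)"
        using of_rat_dense[of r "r + e / (norm u + 1)"] e by auto
      have "dist (real_of_rat s *\<^sub>R u) (r *\<^sub>R u) = (real_of_rat s - r) * norm u"
        using s(1) by (simp add: dist_norm flip: scaleR_diff_left)
      also have "\<dots> \<le> (real_of_rat s - r) * (norm u + 1)"
        using s(1) by (intro mult_left_mono) auto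
      also have "\<dots> < e" using s(2) pos by (simp add: field_simps)
      finally show ?thesis using rat by blast
    qed
    then have "r *\<^sub>R u \<in> closure (closure Q)"
      unfolding closure_approachable[of _ "closure Q"] by blast
    then show ?thesis by simp
  qed
qed

text \<open>Finite rational combinations of the sequence are coded by lists, which are countable.
  Indices may repeat, so that addition is concatenation.\<close>

lemma range_subset_separable_subspace:
  fixes X :: "nat \<Rightarrow> 'a::real_normed_vector"
  obtains q :: "nat \<Rightarrow> 'a" where "range X \<subseteq> closure (range q)" and "subspace (closure (range q))"
proof -
  define s :: "(rat \<times> nat) list \<Rightarrow> 'a"
    where "s l = sum_list (map (\<lambda>(r, n). real_of_rat r *\<^sub>R X n) l)" for l
  have "subspace (closure (range s))"
  proof (rule subspace_closure_rational_span)
    have "s [] = 0" by (simp add: s_def)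
    then show "0 \<in> range s" by (metis rangeI)
    have "s l + s m = s (l @ m)" for l m by (simp add: s_def)
    then show "u + v \<in> range s" if "u \<in> range s" "v \<in> range s" for u v using that by auto
    have "real_of_rat c *\<^sub>R s l = s (map (\<lambda>(r, n). (c * r, n)) l)" for c l
      by (induction l) (auto simp: s_def scaleR_right_distrib of_rat_mult)
    then show "real_of_rat r *\<^sub>R u \<in> range s" if "u \<in> range s" for r u using that by auto
  qed
  moreover have "X n = s [(1, n)]" for n by (simp add: s_def)
  then have "range X \<subseteq> closure (range s)" using closure_subset by blast
  moreover have "range (s \<circ> from_nat) = range s"
    by (simp only: image_comp[symmetric] surj_from_nat)
  ultimately show ?thesis using that[of "s \<circ> from_nat"] by simp
qed

text \<open>Norming functionals of a dense sequence suffice: if all vanish at z and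
  \<open>q n\<close> is within norm z / 2 of z, then \<open>q n\<close> itself has norm below norm z
  / 2, which is impossible for nonzero z.\<close>

lemma countable_separating_functionals:
  fixes q :: "nat \<Rightarrow> 'a::real_normed_vector"
  obtains d :: "nat \<Rightarrow> 'a \<Rightarrow>\<^sub>L real"
  where "\<And>n. norm (d n) \<le> 1" and "\<And>z. z \<in> closure (range q) \<Longrightarrow> (\<And>n. d n z = 0) \<Longrightarrow> z = 0"
proof -
  have "\<exists>f :: 'a \<Rightarrow>\<^sub>L real. norm f \<le> 1 \<and> blinfun_apply f (q n) = norm (q n)" for n
    by (rule norming_functional[of "q n"]) blast
  then obtain d :: "nat \<Rightarrow> 'a \<Rightarrow>\<^sub>L real"
    where d: "\<And>n. norm (d n) \<le> 1" "\<And>n. d n (q n) = norm (q n)" by metis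
  show ?thesis
  proof (rule that[OF d(1)])
    fix z assume z: "z \<in> closure (range q)" and 0: "\<And>n. d n z = 0"
    show "z = 0"
    proof (rule ccontr)
      assume "z \<noteq> 0"
      then obtain n where n: "dist (q n) z < norm z / 2"
        using z unfolding closure_approachable by (metis half_gt_zero image_iff zero_less_norm_iff)
      have "norm (q n) = d n (q n - z)" using 0 d(2) by (simp add: blinfun.diff_right)
      also have "\<dots> \<le> norm (q n - z)" using blinfun_apply_le[OF d(1)] abs_le_D1 by blast
      finally have "norm (q n) < norm z / 2" using n by (simp add: dist_norm)
      then show False using n norm_triangle_ineq2[of z "q n"] by (simp add: dist_norm norm_minus_commute)
    qed
  qed
qed

text \<open>Compactness of a countable product of intervals yields sequential compactness and
  replaces the diagonal argument.\<close>

lemma pointwise_convergent_subsequence: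
  fixes a :: "nat \<Rightarrow> nat \<Rightarrow> real"
  assumes "\<And>k n. \<bar>a k n\<bar> \<le> B"
  obtains r l where "strict_mono r" and "\<And>n. (\<lambda>k. a (r k) n) \<longlonglongrightarrow> l n"
proof -
  have "seq_compact (Pi\<^sub>E UNIV (\<lambda>_. cball 0 B) :: (nat \<Rightarrow> real) set)"
    by (intro compact_imp_seq_compact compact_PiE_UNIV compact_cball)
  moreover have "\<forall>k. a k \<in> Pi\<^sub>E UNIV (\<lambda>_. cball 0 B)" using assms by auto
  ultimately obtain l r where r: "strict_mono r" "(a \<circ> r) \<longlonglongrightarrow> l"
    unfolding seq_compact_def by blast
  have "(\<lambda>k. a (r k) n) \<longlonglongrightarrow> l n" for n
    using continuous_on_tendsto_compose[OF continuous_on_product_coordinates r(2), of n]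
    by simp
  then show ?thesis using that r(1) by blast
qed

text \<open>
  On the closed span of the sequence countably many functionals separate points. Along a
  subsequence on which all of them converge, every weak cluster point is therefore the same.
\<close>

theorem weakly_convergent_subsequence:
  fixes X :: "nat \<Rightarrow> 'a::real_normed_vector"
  assumes refl: "reflexive_space TYPE('a)" and B: "\<And>n. norm (X n) \<le> B"
  obtains r x where "strict_mono r" and "weakly_converges (X \<circ> r) x"
proof -
  obtain q :: "nat \<Rightarrow> 'a" where XZ: "range X \<subseteq> closure (range q)"
    and Z: "subspace (closure (range q))"
    by (rule range_subset_separable_subspace)
  obtain d :: "nat \<Rightarrow> 'a \<Rightarrow>\<^sub>L real" where d: "\<And>n. norm (d n) \<le> 1"
    "\<And>z. z \<in> closure (range q) \<Longrightarrow> (\<And>n. d n z = 0) \<Longrightarrow> z = 0"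
    using countable_separating_functionals[of q] by blast
  have "\<bar>d n (X k)\<bar> \<le> B" for k n
    using blinfun_apply_le[OF d(1), of n "X k"] B[of k] by simp
  then obtain r l where r: "strict_mono r" and l: "\<And>n. (\<lambda>k. d n (X (r k))) \<longlonglongrightarrow> l n"
    using pointwise_convergent_subsequence[of "\<lambda>k n. d n (X k)" B] by blast
  \<comment> \<open>This is needed for a general filter: first for the whole subsequence, then for
    the indices where convergence fails.\<close>
  have cluster: "\<exists>G x. G \<le> F \<and> G \<noteq> bot \<and> x \<in> closure (range q) \<and> (\<forall>n. d n x = l n) \<and>
      (\<forall>f :: 'a \<Rightarrow>\<^sub>L real. ((\<lambda>k. f (X (r k))) \<longlongrightarrow> f x) G)"
    if F: "F \<le> sequentially" "F \<noteq> bot" for F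
  proof -
    obtain G x where G: "G \<le> F" "G \<noteq> bot"
      and lim: "\<And>f :: 'a \<Rightarrow>\<^sub>L real. ((\<lambda>k. f (X (r k))) \<longlongrightarrow> f x) G"
      using weak_cluster_point[OF refl F(2), of "X \<circ> r" B] B by auto
    have "x \<in> closure (range q)"
    proof (rule ccontr)
      assume "x \<notin> closure (range q)"
      then obtain f :: "'a \<Rightarrow>\<^sub>L real" where f: "\<And>z. z \<in> closure (range q) \<Longrightarrow> f z = 0" "f x \<noteq> 0"
        \<comment> \<open>A functional vanishing on the closed span but not at x would contradict
          weak clustering.\<close>
        using closed_subspace_separation[OF Z closed_closure, of x] by blast
      have "f (X (r k)) = 0" for k using f(1) XZ by blast
      then have zero: "((\<lambda>_. 0) \<longlongrightarrow> f x) G" using lim[of f] by simp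
      show False using f(2) tendsto_unique[OF G(2) zero tendsto_const] by simp
    qed
    moreover have "d n x = l n" for n
      using tendsto_unique[OF G(2) lim tendsto_mono[OF order_trans[OF G(1) F(1)] l]] .
    ultimately show ?thesis using G lim by blast
  qed
  obtain x where x: "x \<in> closure (range q)" "\<And>n. d n x = l n"
    using cluster[OF order_refl] by auto
  have "(\<lambda>k. f (X (r k))) \<longlonglongrightarrow> f x" for f :: "'a \<Rightarrow>\<^sub>L real"
  proof (rule ccontr)
    assume "\<not> (\<lambda>k. f (X (r k))) \<longlonglongrightarrow> f x"
    then obtain e where e: "e > 0" and
      freq: "\<not> eventually (\<lambda>k. dist (f (X (r k))) (f x) < e) sequentially"
      unfolding tendsto_iff by blast
    \<comment> \<open>Along the indices where \<open>f\<close> stays e-far from f x there is still a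
      weak cluster point y. It shares all values \<open>l n\<close> with x, hence equals x, which is
      absurd.\<close>
    define F where "F = inf sequentially (principal {k. \<not> dist (f (X (r k))) (f x) < e})"
    have "F \<noteq> bot"
      using freq by (simp add: F_def trivial_limit_def[symmetric] eventually_inf_principal
          flip: eventually_False)
    moreover have "F \<le> sequentially" by (simp add: F_def)
    ultimately obtain G y where G: "G \<le> F" "G \<noteq> bot" and y: "y \<in> closure (range q)"
      "\<And>n. d n y = l n" and lim: "((\<lambda>k. f (X (r k))) \<longlongrightarrow> f y) G"
      using cluster by blast
    have "y - x = 0"
      using d(2)[of "y - x"] subspace_diff[OF Z y(1) x(1)] x(2) y(2) by (simp add: blinfun.diff_right)
    then have "eventually (\<lambda>k. dist (f (X (r k))) (f x) < e) G"
      using lim e by (auto simp: tendsto_iff)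
    moreover have "eventually (\<lambda>k. \<not> dist (f (X (r k))) (f x) < e) G"
      using filter_leD[OF G(1)] by (simp add: F_def eventually_inf_principal)
    ultimately have "eventually (\<lambda>_. False) G" by eventually_elim simp
    then show False using G(2) by (simp add: eventually_False)
  qed
  then show ?thesis using that[OF r, of x] by (simp add: weakly_converges_def)
qed

section \<open>Norm attainment of compact operators\<close>

text \<open>Testing with a norming functional of the limit reduces this to real sequences.\<close>

lemma weakly_converges_norm_le:
  fixes x :: "'a::real_normed_vector"
  assumes "weakly_converges X x" and "\<And>n. norm (X n) \<le> B"
  shows "norm x \<le> B"
proof -
  obtain f :: "'a \<Rightarrow>\<^sub>L real" where f: "norm f \<le> 1" "f x = norm x" by (rule norming_functional)
  have "(\<lambda>n. f (X n)) \<longlonglongrightarrow> norm x" using assms(1) unfolding weakly_converges_def f(2)[symmetric]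
    by blast
  moreover have "f (X n) \<le> B" for n
    using blinfun_apply_le[OF f(1), of "X n"] assms(2)[of n] by linarith
  ultimately show ?thesis by (intro LIMSEQ_le_const2) auto
qed

text \<open>Composition with \<open>T\<close> turns functionals on the target into functionals on
  the domain, so both limits agree under every functional.\<close>

lemma weakly_converges_image_unique:
  fixes T :: "'a::real_normed_vector \<Rightarrow>\<^sub>L 'b::real_normed_vector"
  assumes "weakly_converges X x" and "(\<lambda>n. T (X n)) \<longlonglongrightarrow> w"
  shows "T x = w"
proof (rule functionals_separate_points)
  fix g :: "'b \<Rightarrow>\<^sub>L real"
  have "(\<lambda>n. (g o\<^sub>L T) (X n)) \<longlonglongrightarrow> (g o\<^sub>L T) x"
    using assms(1) unfolding weakly_converges_def by blast
  moreover have "(\<lambda>n. g (T (X n))) \<longlonglongrightarrow> g w"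
    using assms(2) by (intro tendsto_intros)
  ultimately show "g (T x) = g w" using LIMSEQ_unique by auto
qed

lemma maximizing_sequence_subconverges:
  fixes T :: "'a::real_normed_vector \<Rightarrow>\<^sub>L 'b::real_normed_vector"
  assumes refl: "reflexive_space TYPE('a)" and KK: "kadets_klee_space TYPE('a)"
    and T: "compact_operator T" "norm T = 1"
    and X: "\<And>n. norm (X n) = 1" and TX: "(\<lambda>n. norm (T (X n))) \<longlonglongrightarrow> 1"
  obtains r u where "strict_mono r" and "(X \<circ> r) \<longlonglongrightarrow> u" and "u \<in> norm_attainment_set T"
proof -
  have "seq_compact (closure (T ` cball 0 1))"
    using T(1) by (simp add: compact_operator_def compact_imp_seq_compact)
  moreover have "\<forall>n. T (X n) \<in> closure (T ` cball 0 1)"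
    using X by (intro allI subsetD[OF closure_subset] imageI) simp
  ultimately obtain w r where "w \<in> closure (T ` cball 0 1)"
    and r: "strict_mono r" and w: "((\<lambda>n. T (X n)) \<circ> r) \<longlonglongrightarrow> w"
    by (rule seq_compactE)
  have "(\<lambda>n. norm (T (X (r n)))) \<longlonglongrightarrow> norm w"
    using tendsto_norm[OF w] by simp
  moreover have "(\<lambda>n. norm (T (X (r n)))) \<longlonglongrightarrow> 1"
    using LIMSEQ_subseq_LIMSEQ[OF TX r] by (simp add: o_def)
  ultimately have "norm w = 1" by (rule LIMSEQ_unique)
  obtain s u where s: "strict_mono s" and u: "weakly_converges ((X \<circ> r) \<circ> s) u"
    using weakly_convergent_subsequence[OF refl, of "X \<circ> r" 1] X by auto
  have "T u = w"
    using LIMSEQ_subseq_LIMSEQ[OF w s] by (intro weakly_converges_image_unique[OF u]) (simp add: o_def)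
  \<comment> \<open>The weak limit has norm at most 1, while its image \<open>w\<close> has norm 1
    and \<open>T\<close> has norm 1; hence u has norm exactly 1, as the Kadets-Klee property
    requires.\<close>
  moreover have "norm u \<le> 1" using u X by (intro weakly_converges_norm_le[OF u]) simp
  ultimately have "norm u = 1" "norm (T u) = 1"
    using norm_blinfun[of T u] \<open>norm w = 1\<close> T(2) by auto
  moreover have "((X \<circ> r) \<circ> s) \<longlonglongrightarrow> u"
    using KK u X \<open>norm u = 1\<close> unfolding kadets_klee_space_def by simp
  ultimately show ?thesis
    using that[of "r \<circ> s" u] r s T(2) by (simp add: norm_attainment_set_def strict_mono_o o_assoc)
qed

lemma almost_maximizers_near_norm_attainment_set:
  fixes T :: "'a::real_normed_vector \<Rightarrow>\<^sub>L 'b::real_normed_vector"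
  assumes "reflexive_space TYPE('a)" and "kadets_klee_space TYPE('a)"
    and "compact_operator T" and "norm T = 1" and "\<epsilon> > 0"
  shows "\<exists>\<delta>>0. \<forall>x\<in>sphere 0 1. norm (T x) > 1 - \<delta> \<longrightarrow>
    (\<exists>u\<in>norm_attainment_set T. norm (u - x) < \<epsilon>)"
proof (rule ccontr)
  assume neg: "\<not> ?thesis"
  \<comment> \<open>Failure for every threshold is used with 1 / (n + 1).\<close>
  have "\<exists>x. norm x = 1 \<and> norm (T x) > 1 - inverse (real (Suc n)) \<and>
      (\<forall>u\<in>norm_attainment_set T. \<not> norm (u - x) < \<epsilon>)" for n
  proof -
    have "inverse (real (Suc n)) > 0" by simp
    then show ?thesis using neg unfolding mem_sphere_0 Bex_def Ball_def by blast
  qed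
  then obtain X where X: "\<And>n. norm (X n) = 1" "\<And>n. norm (T (X n)) > 1 - inverse (real (Suc n))"
    and far: "\<And>n u. u \<in> norm_attainment_set T \<Longrightarrow> \<not> norm (u - X n) < \<epsilon>"
    by metis
  have "(\<lambda>n. norm (T (X n))) \<longlonglongrightarrow> 1"
  proof (rule tendsto_sandwich)
    show "eventually (\<lambda>n. 1 - inverse (real (Suc n)) \<le> norm (T (X n))) sequentially"
      using X(2) by (simp add: less_imp_le)
    show "eventually (\<lambda>n. norm (T (X n)) \<le> 1) sequentially"
      using norm_blinfun[of T] X(1) \<open>norm T = 1\<close> by (intro always_eventually allI) (metis mult_1)
    show "(\<lambda>n. 1 - inverse (real (Suc n))) \<longlonglongrightarrow> 1"
      using tendsto_diff[OF tendsto_const LIMSEQ_inverse_real_of_nat, of 1] by simp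
  qed simp
  then obtain r u where "(X \<circ> r) \<longlonglongrightarrow> u" and u: "u \<in> norm_attainment_set T"
    using maximizing_sequence_subconverges[of T X] assms X(1) by blast
  then obtain n where "dist (X (r n)) u < \<epsilon>"
    using \<open>\<epsilon> > 0\<close> unfolding tendsto_iff by (auto simp: eventually_sequentially)
  then show False using far[OF u, of "r n"] by (simp add: dist_norm norm_minus_commute)
qed

section \<open>Segments in the unit ball and extreme points\<close>

lemma norm_segment_le_1:
  fixes a s :: "'a::real_normed_vector"
  assumes "norm (a + s) \<le> 1" and "norm (a - s) \<le> 1" and c: "\<bar>c\<bar> \<le> 1"
  shows "norm (a + c *\<^sub>R s) \<le> 1"
proof -
  \<comment> \<open>The weights are (1 + c) / 2 and (1 - c) / 2, with the factor 2 cleared.\<close>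
  have "p *\<^sub>R (a + s) + q *\<^sub>R (a - s) = (p + q) *\<^sub>R a + (p - q) *\<^sub>R s" for p q :: real
    by (simp add: scaleR_left_distrib scaleR_left_diff_distrib scaleR_right_distrib
        scaleR_right_diff_distrib)
  from this[of "1 + c" "1 - c"]
  have "2 *\<^sub>R (a + c *\<^sub>R s) = (1 + c) *\<^sub>R (a + s) + (1 - c) *\<^sub>R (a - s)"
    by (simp add: scaleR_right_distrib)
  then have "2 * norm (a + c *\<^sub>R s) = norm ((1 + c) *\<^sub>R (a + s) + (1 - c) *\<^sub>R (a - s))"
    by (metis norm_scaleR abs_numeral)
  also have "\<dots> \<le> (1 + c) * norm (a + s) + (1 - c) * norm (a - s)"
    using c by (intro order_trans[OF norm_triangle_ineq]) simp
  also have "\<dots> \<le> (1 + c) * 1 + (1 - c) * 1"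
    using assms by (intro add_mono mult_left_mono) auto
  finally show ?thesis by simp
qed

text \<open>
  \<open>t \<mapsto> norm (a + t *\<^sub>R s)\<close> is convex and bounded by \<open>1\<close> on \<open>{-1..1}\<close>, so it is constantly \<open>1\<close>
  as soon as it takes the value \<open>1\<close> at an interior point.
\<close>

lemma norm_interior_of_segment:
  fixes a s :: "'a::real_normed_vector"
  assumes "norm (a + s) \<le> 1" and "norm (a - s) \<le> 1" and t: "0 \<le> t" "t < 1"
  shows "norm (a + t *\<^sub>R s) = 1 \<longleftrightarrow> norm a = 1"
proof -
  note le = norm_segment_le_1[OF assms(1,2)]
  show ?thesis
  proof
    assume 1: "norm (a + t *\<^sub>R s) = 1"
    \<comment> \<open>The point lies between a and a + s with positive weight on a, so norm a < 1
      would push its norm below 1.\<close>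
    have "a + t *\<^sub>R s = (1 - t) *\<^sub>R a + t *\<^sub>R (a + s)" by (simp add: algebra_simps)
    then have "1 \<le> (1 - t) * norm a + t * norm (a + s)"
      using 1 t norm_triangle_ineq[of "(1 - t) *\<^sub>R a" "t *\<^sub>R (a + s)"] by simp
    also have "\<dots> \<le> (1 - t) * norm a + t * 1"
      using assms by (intro add_left_mono mult_left_mono) auto
    finally have "(1 - t) * 1 \<le> (1 - t) * norm a" by simp
    then have "1 \<le> norm a" using t by (simp only: mult_le_cancel_left_pos)
    then show "norm a = 1" using le[of 0] by simp
  next
    assume 1: "norm a = 1"
    \<comment> \<open>Here a is the midpoint of two points of the ball, so neither can have norm
      below 1.\<close>
    have "2 *\<^sub>R a = (a + t *\<^sub>R s) + (a + (- t) *\<^sub>R s)" by (simp add: scaleR_2)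
    then have "2 * norm a \<le> norm (a + t *\<^sub>R s) + norm (a + (- t) *\<^sub>R s)"
      by (metis norm_triangle_ineq norm_scaleR abs_numeral)
    then show "norm (a + t *\<^sub>R s) = 1" using 1 t le[of t] le[of "- t"] by simp
  qed
qed

text \<open>The symmetric form provides a perturbation direction that is admissible with both
  signs.\<close>

lemma not_extreme_point_of_cball_iff:
  fixes a :: "'a::real_normed_vector"
  assumes "norm a \<le> 1"
  shows "\<not> a extreme_point_of cball 0 1 \<longleftrightarrow> (\<exists>s. s \<noteq> 0 \<and> norm (a + s) \<le> 1 \<and> norm (a - s) \<le> 1)"
proof
  assume "\<not> a extreme_point_of cball 0 1"
  then obtain b c where bc: "norm b \<le> 1" "norm c \<le> 1" "a \<in> open_segment b c"
    using assms by (auto simp: extreme_point_of_def)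
  then obtain t where "b \<noteq> c" and t: "0 < t" "t < 1" "a = (1 - t) *\<^sub>R b + t *\<^sub>R c"
    by (auto simp: in_segment)
  \<comment> \<open>This is the largest step for which t - m and t + m both stay in [0, 1].\<close>
  define m where "m = min t (1 - t)"
  define s where "s = m *\<^sub>R (c - b)"
  have m: "0 < m" "m \<le> t" "m \<le> 1 - t" using t by (auto simp: m_def)
  have conv: "norm ((1 - k) *\<^sub>R b + k *\<^sub>R c) \<le> 1" if "0 \<le> k" "k \<le> 1" for k
    using convexD_alt[OF convex_cball, of b 0 1 c k] bc(1,2) that by simp
  have "a + s = (1 - (t + m)) *\<^sub>R b + (t + m) *\<^sub>R c" "a - s = (1 - (t - m)) *\<^sub>R b + (t - m) *\<^sub>R c"
    by (simp_all add: t(3) s_def algebra_simps)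
  then have "norm (a + s) \<le> 1" "norm (a - s) \<le> 1"
    using conv[of "t + m"] conv[of "t - m"] m t by auto
  moreover have "s \<noteq> 0" using m \<open>b \<noteq> c\<close> by (simp add: s_def)
  ultimately show "\<exists>s. s \<noteq> 0 \<and> norm (a + s) \<le> 1 \<and> norm (a - s) \<le> 1" by blast
next
  assume "\<exists>s. s \<noteq> 0 \<and> norm (a + s) \<le> 1 \<and> norm (a - s) \<le> 1"
  then obtain s where s: "s \<noteq> 0" "norm (a + s) \<le> 1" "norm (a - s) \<le> 1" by blast
  have "midpoint (a - s) (a + s) = a"
    by (simp add: midpoint_eq_iff)
  moreover have "a - s \<noteq> a + s"
  proof
    assume "a - s = a + s"
    then have "s + s = 0" by (simp add: diff_eq_eq add.assoc)
    then show False using s(1) by (simp flip: scaleR_2)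
  qed
  ultimately have "a \<in> open_segment (a - s) (a + s)"
    by (metis midpoint_in_open_segment)
  then show "\<not> a extreme_point_of cball 0 1"
    using s(2,3) unfolding extreme_point_of_def by (meson mem_cball_0)
qed

theorem theorem3p4:
  fixes T :: "'a::banach \<Rightarrow>\<^sub>L 'b::banach"
  assumes "reflexive_space TYPE('a)"
    and "kadets_klee_space TYPE('a)"
    and "compact_operator T"
    and "norm T = 1"
    and "\<not> extreme_contraction T"
  shows "\<forall>\<epsilon>>0. \<exists>A :: 'a \<Rightarrow>\<^sub>L 'b.
           nontrivial_uniform_BPB_approximation \<epsilon> T A \<and>
           norm_attainment_set A = norm_attainment_set T \<and>
           \<not> extreme_contraction A"
proof (intro allI impI)
  fix \<epsilon> :: real
  assume "\<epsilon> > 0"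
  obtain S where S: "S \<noteq> 0" "norm (T + S) \<le> 1" "norm (T - S) \<le> 1"
    using assms(4,5) not_extreme_point_of_cball_iff[of T] by (auto simp: extreme_contraction_def)
  \<comment> \<open>The bound 1 / 2 keeps \<open>T + (2 * t) *\<^sub>R S\<close> in the unit ball;
    the other bound gives t * norm S <= \<epsilon> / 2.\<close>
  define t where "t = min (1 / 2) (\<epsilon> / (2 * norm S))"
  have t: "0 < t" "t \<le> 1 / 2" and "t \<le> \<epsilon> / (2 * norm S)"
    using \<open>\<epsilon> > 0\<close> S(1) by (auto simp: t_def)
  then have small: "t * norm S < \<epsilon>" using \<open>\<epsilon> > 0\<close> S(1) by (simp add: field_simps)
  define A where "A = T + t *\<^sub>R S"
  have "norm A = 1"
    using norm_interior_of_segment[OF S(2,3), of t] t assms(4) by (simp add: A_def)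
  have bound: "norm (U x) \<le> 1" if "norm U \<le> 1" "norm x = 1" for U :: "'a \<Rightarrow>\<^sub>L 'b" and x
    using norm_blinfun[of U x] that by simp
  \<comment> \<open>The segment argument, used above for operators, is now applied to the image
    vectors of each unit vector.\<close>
  have "norm (A x) = 1 \<longleftrightarrow> norm (T x) = 1" if "norm x = 1" for x
    using norm_interior_of_segment[of "T x" "S x" t] bound[OF S(2) that] bound[OF S(3) that] t
    by (simp add: A_def blinfun.add_left blinfun.diff_left blinfun.scaleR_left)
  then have M: "norm_attainment_set A = norm_attainment_set T"
    using \<open>norm A = 1\<close> assms(4) by (auto simp: norm_attainment_set_def)
  have "norm (T - A) < \<epsilon>" using small t(1) by (simp add: A_def)
  \<comment> \<open>Since \<open>A\<close> and \<open>T\<close> attain their norms at the same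
    points, the points found near almost maximizers of \<open>T\<close> serve for
    \<open>A\<close>.\<close>
  then have "uniform_BPB_approximation \<epsilon> T A"
    using almost_maximizers_near_norm_attainment_set[OF assms(1-4) \<open>\<epsilon> > 0\<close>]
      assms(4) \<open>norm A = 1\<close> M
    by (simp add: uniform_BPB_approximation_def)
  moreover have "A \<noteq> T" using t(1) S(1) by (simp add: A_def)
  moreover have "\<not> extreme_contraction A"
  proof -
    \<comment> \<open>\<open>A\<close> is the midpoint of two distinct contractions,
      \<open>T\<close> and \<open>T + (2 * t) *\<^sub>R S\<close>.\<close>
    have "A + t *\<^sub>R S = T + (t + t) *\<^sub>R S"
      by (simp only: A_def scaleR_left_distrib add.assoc)
    moreover have "A - t *\<^sub>R S = T" by (simp add: A_def)
    ultimately have "norm (A + t *\<^sub>R S) \<le> 1" "norm (A - t *\<^sub>R S) \<le> 1"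
      using norm_segment_le_1[OF S(2,3), of "t + t"] t assms(4) by auto
    then show ?thesis
      using not_extreme_point_of_cball_iff[of A] \<open>norm A = 1\<close> t(1) S(1)
      unfolding extreme_contraction_def by (metis less_irrefl order_refl scaleR_eq_0_iff)
  qed
  ultimately show "\<exists>A. nontrivial_uniform_BPB_approximation \<epsilon> T A \<and>
      norm_attainment_set A = norm_attainment_set T \<and> \<not> extreme_contraction A"
    using M by (auto simp: nontrivial_uniform_BPB_approximation_def)
qed

end
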